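(* There is an absolute constant $K>0$ such that for all integers $m,n\ge 2$, every known permutation $\sigma$ of $[n]$, and every permutation $\pi$ of $[n]$ (possibly different from $\sigma$) the following holds. In the sequential access model in which the voters arrive in the order $\pi(1),\pi(2),\dots,\pi(n)$, there is a Preference Elicitation algorithm (knowing $\sigma$) for the class of all profiles of $n$ voters over $m$ candidates that are single crossing with respect to $\sigma$, whose query complexity is at most $K\,(mn+m^2\log n)$; that is, the query complexity is $O(mn+m^2\log n)$.
   Context: Let $\mathcal{C}$ be a set of $m$ candidates and $[n]=\{1,\dots,n\}$ the set of voters. A preference is a strict total order on $\mathcal{C}$; a profile is an $n$-tuple $\mathcal{P}=(\succ_1,\dots,\succ_n)$ of preferences. For a permutation $\sigma$ of $[n]$, $\mathcal{P}$ is single crossing with respect to $\sigma$ if for every two distinct $x,y\in\mathcal{C}$, whenever $x\succ_{\sigma(i)}y$ and $x\succ_{\sigma(j)}y$ with $1\le i<j\le n$, then $x\succ_{\sigma(k)}y$ for every $i\le k\le j$. The oracle $\mathrm{Query}(x\succ_\ell y)$ ($\ell$ a voter, $x\ne y$ candidates) returns true if voter $\ell$ prefers $x$ to $y$, and false otherwise. A Preference Elicitation algorithm for a class of profiles is a deterministic adaptive procedure that, for every unknown profile $\mathcal{P}$ in the class, outputs $\mathcal{P}$ exactly using only oracle calls. Its query complexity is the maximum, over profiles in the class, of the number of pairs (voter $\ell$, unordered pair $\{x,y\}$ of distinct candidates) for which the algorithm compares $x$ and $y$ for voter $\ell$ (repeated calls are counted once). In the sequential access model the voters arrive one after another in a given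 order; once a voter has arrived (its identity being known to the algorithm) the algorithm may query that voter as often as it likes, then releases the voter and moves on to the next one; a released voter can never be queried again. Logarithms are base 2. *)

theory Defs
  imports Complex_Main "HOL-Library.FuncSet" "HOL-Combinatorics.Permutations"
begin

type_synonym cand = nat
type_synonym voter = nat
type_synonym preference = "(cand \<times> cand) set"
type_synonym profile = "voter \<Rightarrow> preference"

text \<open>A preference contains the pair \<open>(x, y)\<close> iff \<open>x\<close> is strictly preferred to \<open>y\<close>.\<close>

definition preferences :: "cand set \<Rightarrow> preference set" where
  "preferences C = {r. r \<subseteq> C \<times> C \<and> strict_linear_order_on C r}"

text \<open>An \<open>n\<close>-tuple of preferences is a function on \<open>{1..n}\<close> that is \<open>undefined\<close> elsewhere, so that
  equality of profiles means agreement on all \<open>n\<close> voters.\<close>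

definition profiles :: "cand set \<Rightarrow> nat \<Rightarrow> profile set" where
  "profiles C n = {1..n} \<rightarrow>\<^sub>E preferences C"

definition single_crossing :: "cand set \<Rightarrow> nat \<Rightarrow> (nat \<Rightarrow> voter) \<Rightarrow> profile \<Rightarrow> bool" where
  "single_crossing C n \<sigma> P \<longleftrightarrow>
     (\<forall>x\<in>C. \<forall>y\<in>C. x \<noteq> y \<longrightarrow>
       (\<forall>i j. 1 \<le> i \<and> i < j \<and> j \<le> n \<and> (x, y) \<in> P (\<sigma> i) \<and> (x, y) \<in> P (\<sigma> j) \<longrightarrow>
         (\<forall>k. i \<le> k \<and> k \<le> j \<longrightarrow> (x, y) \<in> P (\<sigma> k))))"

definition single_crossing_profiles :: "cand set \<Rightarrow> nat \<Rightarrow> (nat \<Rightarrow> voter) \<Rightarrow> profile set" where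
  "single_crossing_profiles C n \<sigma> = {P \<in> profiles C n. single_crossing C n \<sigma> P}"

definition oracle_query :: "profile \<Rightarrow> voter \<Rightarrow> cand \<Rightarrow> cand \<Rightarrow> bool" where
  "oracle_query P l x y \<longleftrightarrow> (x, y) \<in> P l"

text \<open>A deterministic adaptive procedure with sequential access is a well-founded decision tree.
  \<open>Query x y t f\<close> compares \<open>x\<close> with \<open>y\<close> for the voter currently present and continues
  with \<open>t\<close> on the answer true and with \<open>f\<close> on the answer false. \<open>Advance k\<close> releases the
  current voter (if any), lets the next one arrive, and continues with \<open>k v\<close>, where \<open>v\<close> is the
  identity of the newly arrived voter. There is no constructor for going back to a released voter.\<close>

datatype algorithm =
    Output profile
  | Query cand cand algorithm algorithm
  | Advance "voter \<Rightarrow> algorithm"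

primrec admissible :: "cand set \<Rightarrow> algorithm \<Rightarrow> bool" where
  "admissible C (Output R) \<longleftrightarrow> True"
| "admissible C (Query x y t f) \<longleftrightarrow>
     x \<in> C \<and> y \<in> C \<and> x \<noteq> y \<and> admissible C t \<and> admissible C f"
| "admissible C (Advance k) \<longleftrightarrow> (\<forall>v. admissible C (k v))"

text \<open>In both functions below, \<open>cur\<close> is the voter currently present (\<open>None\<close> before the first
  arrival) and \<open>vs\<close> lists the voters yet to arrive. The result \<open>None\<close> means that the procedure
  queried with no voter present or asked for a further voter after the last one.\<close>

primrec result :: "algorithm \<Rightarrow> profile \<Rightarrow> voter option \<Rightarrow> voter list \<Rightarrow> profile option" where
  "result (Output R) P cur vs = Some R"
| "result (Query x y t f) P cur vs =
     (case cur of
        None \<Rightarrow> None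
      | Some l \<Rightarrow> if oracle_query P l x y then result t P cur vs else result f P cur vs)"
| "result (Advance k) P cur vs =
     (case vs of
        [] \<Rightarrow> None
      | v # vs' \<Rightarrow> result (k v) P (Some v) vs')"

text \<open>The set of pairs (voter, unordered pair of candidates) compared during the run; being a set,
  it counts repeated comparisons once.\<close>

primrec comparisons ::
    "algorithm \<Rightarrow> profile \<Rightarrow> voter option \<Rightarrow> voter list \<Rightarrow> (voter \<times> cand set) set" where
  "comparisons (Output R) P cur vs = {}"
| "comparisons (Query x y t f) P cur vs =
     (case cur of
        None \<Rightarrow> {}
      | Some l \<Rightarrow> insert (l, {x, y})
          (if oracle_query P l x y then comparisons t P cur vs else comparisons f P cur vs))"
| "comparisons (Advance k) P cur vs =
     (case vs of
        [] \<Rightarrow> {}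
      | v # vs' \<Rightarrow> comparisons (k v) P (Some v) vs')"

definition elicits :: "cand set \<Rightarrow> voter list \<Rightarrow> profile set \<Rightarrow> algorithm \<Rightarrow> bool" where
  "elicits C vs F A \<longleftrightarrow> admissible C A \<and> (\<forall>P\<in>F. result A P None vs = Some P)"

definition query_complexity :: "voter list \<Rightarrow> profile set \<Rightarrow> algorithm \<Rightarrow> nat" where
  "query_complexity vs F A = Max ((\<lambda>P. card (comparisons A P None vs)) ` F)"

text \<open>The maximum and the cardinalities in \<open>query_complexity\<close> are proper: the sets involved are
  finite, and the class of profiles is nonempty.\<close>

lemma finite_comparisons: "finite (comparisons A P cur vs)"
  by (induction A arbitrary: cur vs) (auto split: option.split list.split)

lemma finite_single_crossing_profiles:
  assumes "finite C"
  shows "finite (single_crossing_profiles C n \<sigma>)"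
proof -
  have "finite (preferences C)"
    using assms by (auto simp: preferences_def intro: finite_subset[of _ "Pow (C \<times> C)"])
  then have "finite (profiles C n)"
    by (auto simp: profiles_def intro: finite_PiE)
  then show ?thesis
    by (simp add: single_crossing_profiles_def)
qed

lemma single_crossing_profiles_nonempty:
  assumes "\<sigma> permutes {1..n}"
  shows "single_crossing_profiles C n \<sigma> \<noteq> {}"
proof -
  define r where "r = {(x, y). x \<in> C \<and> y \<in> C \<and> x < y}"
  have r: "r \<in> preferences C"
    by (auto simp: r_def preferences_def strict_linear_order_on_def trans_def irrefl_def total_on_def)
  have "\<sigma> k \<in> {1..n}" if "1 \<le> k" "k \<le> n" for k
    using permutes_in_image[OF assms, of k] that by simp
  then have "restrict (\<lambda>_. r) {1..n} \<in> single_crossing_profiles C n \<sigma>"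
    using r by (force simp: single_crossing_profiles_def profiles_def single_crossing_def)
  then show ?thesis by blast
qed

end

theory Submission
  imports Defs
begin

text \<open>
  When a voter arrives, its preference is found by insertion sort, starting from the preference of
  the already elicited voter that is nearest in the crossing order. This costs at most \<open>m\<close>
  comparisons plus the number of pairs on which the two voters disagree, and such disagreements are
  charged to the pair. A pair is charged at most \<open>1 + log n\<close> times after the first voter: when it has been
  charged \<open>c\<close> times, \<open>c > 0\<close>, there are two elicited voters that disagree on it and whose distance
  \<open>L\<close> satisfies \<open>2 ^ c * L \<le> 2 * n\<close>. Indeed a further charge needs a voter lying between these two,
  whose nearest elicited voter is then at distance at most \<open>L / 2\<close> and disagrees with it.
\<close>

section \<open>Insertion sort by oracle queries\<close>

text \<open>The continuation \<open>k\<close> receives the finished list, because a decision tree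
  has no sequencing: whatever follows must be grafted onto every leaf. The scan runs from the front
  and stops at the first entry that loses against \<open>x\<close>, so inserting \<open>x\<close>
  near the front is cheap.\<close>

primrec ins_query :: "cand \<Rightarrow> cand list \<Rightarrow> (cand list \<Rightarrow> algorithm) \<Rightarrow> algorithm" where
  "ins_query x [] = (\<lambda>k. k [x])"
| "ins_query x (y # ys) =
     (\<lambda>k. Query x y (k (x # y # ys)) (ins_query x ys (\<lambda>zs. k (y # zs))))"

primrec sort_query :: "cand list \<Rightarrow> (cand list \<Rightarrow> algorithm) \<Rightarrow> algorithm" where
  "sort_query [] = (\<lambda>k. k [])"
| "sort_query (x # xs) = (\<lambda>k. sort_query xs (\<lambda>ys. ins_query x ys k))"

section \<open>Insertion sort as a function of the preference, and the order a list
  represents\<close>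

primrec rel_insert :: "('a \<times> 'a) set \<Rightarrow> 'a \<Rightarrow> 'a list \<Rightarrow> 'a list" where
  "rel_insert r x [] = [x]"
| "rel_insert r x (y # ys) = (if (x, y) \<in> r then x # y # ys else y # rel_insert r x ys)"

primrec rel_sort :: "('a \<times> 'a) set \<Rightarrow> 'a list \<Rightarrow> 'a list" where
  "rel_sort r [] = []"
| "rel_sort r (x # xs) = rel_insert r x (rel_sort r xs)"

primrec list_order :: "'a list \<Rightarrow> ('a \<times> 'a) set" where
  "list_order [] = {}"
| "list_order (x # xs) = {x} \<times> set xs \<union> list_order xs"

lemma list_order_subset: "list_order xs \<subseteq> set xs \<times> set xs"
  by (induction xs) auto

lemma mset_rel_insert [simp]: "mset (rel_insert r x ys) = add_mset x (mset ys)"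
  by (induction ys) auto

lemma mset_rel_sort [simp]: "mset (rel_sort r xs) = mset xs"
  by (induction xs) auto

lemma set_rel_insert [simp]: "set (rel_insert r x ys) = insert x (set ys)"
  by (induction ys) auto

lemma set_rel_sort [simp]: "set (rel_sort r xs) = set xs"
  by (induction xs) auto

lemma distinct_rel_sort [simp]: "distinct (rel_sort r xs) = distinct xs"
  by (metis mset_rel_sort mset_eq_imp_distinct_iff)

text \<open>Where the scan stops, transitivity puts \<open>x\<close> above all later entries as
  well; at an entry that is passed, totality puts that entry above \<open>x\<close>.\<close>

lemma list_order_rel_insert:
  assumes "strict_linear_order_on C r" "insert x (set ys) \<subseteq> C" "x \<notin> set ys" "list_order ys \<subseteq> r"
  shows "list_order (rel_insert r x ys) \<subseteq> r"
  using assms(2-4)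
proof (induction ys)
  case (Cons y ys)
  have tr: "trans r" and tot: "total_on C r"
    using assms(1) by (auto simp: strict_linear_order_on_def)
  show ?case
  proof (cases "(x, y) \<in> r")
    case True
    then have "(x, z) \<in> r" if "z \<in> set ys" for z
      using Cons.prems(3) that transD[OF tr, of x y z] by auto
    then show ?thesis using True Cons.prems(3) by auto
  next
    case False
    then have "(y, x) \<in> r"
      using tot Cons.prems unfolding total_on_def by auto
    then show ?thesis using False Cons by auto
  qed
qed simp

lemma list_order_rel_sort_subset:
  assumes "strict_linear_order_on C r" "set xs \<subseteq> C" "distinct xs"
  shows "list_order (rel_sort r xs) \<subseteq> r"
  using assms(2,3)
proof (induction xs)
  case (Cons x xs)
  then show ?case
    using list_order_rel_insert[OF assms(1), of x "rel_sort r xs"] by simp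
qed simp

lemma list_order_total:
  assumes "x \<in> set xs" "y \<in> set xs" "x \<noteq> y"
  shows "(x, y) \<in> list_order xs \<or> (y, x) \<in> list_order xs"
  using assms by (induction xs) auto

text \<open>A relation that is total on \<open>C\<close> and contained in an asymmetric relation on
  \<open>C\<close> equals it. Hence the sorted list determines the whole preference of the
  voter.\<close>

lemma list_order_rel_sort:
  assumes "r \<in> preferences C" "set xs = C" "distinct xs"
  shows "list_order (rel_sort r xs) = r"
proof
  have r: "strict_linear_order_on C r" "r \<subseteq> C \<times> C"
    using assms(1) by (auto simp: preferences_def)
  show sub: "list_order (rel_sort r xs) \<subseteq> r"
    using list_order_rel_sort_subset[OF r(1)] assms by simp
  show "r \<subseteq> list_order (rel_sort r xs)"
  proof (rule subrelI)
    fix x y assume xy: "(x, y) \<in> r"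
    have tr: "trans r" and ir: "irrefl r"
      using r(1) by (auto simp: strict_linear_order_on_def)
    have "(y, x) \<notin> r"
      using transD[OF tr xy, of x] ir by (auto simp: irrefl_def)
    moreover have "x \<noteq> y" using xy ir by (auto simp: irrefl_def)
    ultimately show "(x, y) \<in> list_order (rel_sort r xs)"
      using list_order_total[of x "rel_sort r xs" y] sub xy r(2) assms(2) by auto
  qed
qed

section \<open>Correctness and cost of sorting by queries\<close>

lemma result_ins_query [simp]:
  "result (ins_query x ys k) P (Some l) vs = result (k (rel_insert (P l) x ys)) P (Some l) vs"
  by (induction ys arbitrary: k) (auto simp: oracle_query_def)

lemma result_sort_query [simp]:
  "result (sort_query xs k) P (Some l) vs = result (k (rel_sort (P l) xs)) P (Some l) vs"
  by (induction xs arbitrary: k) auto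

lemma admissible_ins_query:
  assumes "x \<in> C" "set ys \<subseteq> C" "distinct (x # ys)"
    and "\<And>zs. distinct zs \<Longrightarrow> set zs = insert x (set ys) \<Longrightarrow> admissible C (k zs)"
  shows "admissible C (ins_query x ys k)"
  using assms
proof (induction ys arbitrary: k)
  case (Cons y ys)
  have "admissible C (k (y # zs))" if "distinct zs" "set zs = insert x (set ys)" for zs
    by (rule Cons.prems(4)) (use Cons.prems(3) that in auto)
  then have "admissible C (ins_query x ys (\<lambda>zs. k (y # zs)))"
    using Cons.prems by (intro Cons.IH) auto
  then show ?case using Cons.prems by auto
qed simp

lemma admissible_sort_query:
  assumes "set xs \<subseteq> C" "distinct xs"
    and "\<And>zs. distinct zs \<Longrightarrow> set zs = set xs \<Longrightarrow> admissible C (k zs)"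
  shows "admissible C (sort_query xs k)"
  using assms
proof (induction xs arbitrary: k)
  case (Cons x xs)
  have "admissible C (sort_query xs (\<lambda>ys. ins_query x ys k))"
    using Cons.prems by (intro Cons.IH admissible_ins_query) auto
  then show ?case by simp
qed simp

text \<open>Each entry that is passed accounts for one query with a negative answer, and at most one
  further query ends the scan.\<close>

lemma card_comparisons_ins_query:
  "card (comparisons (ins_query x ys k) P (Some l) vs)
   \<le> Suc (length (filter (\<lambda>y. (x, y) \<notin> P l) ys))
      + card (comparisons (k (rel_insert (P l) x ys)) P (Some l) vs)"
proof (induction ys arbitrary: k)
  case (Cons y ys)
  show ?case
    using Cons[of "\<lambda>zs. k (y # zs)"]
    by (auto simp: oracle_query_def card_insert_if finite_comparisons)
qed simp

primrec inversions :: "('a \<times> 'a) set \<Rightarrow> 'a list \<Rightarrow> nat" where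
  "inversions r [] = 0"
| "inversions r (x # xs) = length (filter (\<lambda>y. (x, y) \<notin> r) xs) + inversions r xs"

lemma card_comparisons_sort_query:
  "card (comparisons (sort_query xs k) P (Some l) vs)
   \<le> length xs + inversions (P l) xs
      + card (comparisons (k (rel_sort (P l) xs)) P (Some l) vs)"
proof (induction xs arbitrary: k)
  case (Cons x xs)
  let ?f = "\<lambda>y. (x, y) \<notin> P l"
  \<comment> \<open>Sorting only permutes the tail, so the entries that \<open>x\<close> has to pass
    are as many as the inversions of the original list with \<open>x\<close> in front.\<close>
  have "length (filter ?f (rel_sort (P l) xs)) = length (filter ?f xs)"
    by (metis mset_filter mset_rel_sort size_mset)
  then show ?case
    using Cons[of "\<lambda>ys. ins_query x ys k"]
      card_comparisons_ins_query[of x "rel_sort (P l) xs" k P l vs]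
    by simp
qed simp

text \<open>If \<open>xs\<close> lists the preference of one voter and \<open>r\<close> is that of
  another, the right-hand side contains each pair on which they disagree exactly once, oriented as
  in \<open>xs\<close>. This turns the cost of sorting into a count of disagreements.\<close>

lemma inversions_eq_card:
  assumes "distinct xs"
  shows "inversions r xs = card (list_order xs - r)"
  using assms
proof (induction xs)
  case (Cons x xs)
  let ?A = "Pair x ` set (filter (\<lambda>y. (x, y) \<notin> r) xs)" and ?B = "list_order xs - r"
  have "list_order (x # xs) - r = ?A \<union> ?B" by auto
  moreover have "?A \<inter> ?B = {}"
    using list_order_subset[of xs] Cons.prems by auto
  moreover have "finite ?B"
    using list_order_subset[of xs] by (auto intro: finite_subset)
  moreover have "card ?A = length (filter (\<lambda>y. (x, y) \<notin> r) xs)"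
    using Cons.prems
    by (subst card_image) (auto simp: inj_on_def distinct_card simp del: set_filter)
  ultimately show ?case
    using Cons by (simp add: card_Un_disjoint)
qed simp

section \<open>The elicitation algorithm\<close>

text \<open>\<open>pos\<close> will be \<open>inv \<sigma>\<close>, so nearness is measured in the
  crossing order and not in the order of arrival. \<open>base\<close> serves the first voter, who
  has no predecessor.\<close>

definition start_list ::
    "(voter \<Rightarrow> nat) \<Rightarrow> cand list \<Rightarrow> (voter \<rightharpoonup> cand list) \<Rightarrow> voter \<Rightarrow> cand list" where
  "start_list pos base M v =
     (if dom M = {} then base
      else the (M (arg_min_on (\<lambda>w. \<bar>int (pos v) - int (pos w)\<bar>) (dom M))))"

text \<open>\<open>M\<close> is the memory: the sorted lists of the voters that have arrived;
  \<open>j\<close> counts the arrivals still to come. The value \<open>undefined\<close> outside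
  \<open>dom M\<close> matches the extensionality built into \<open>profiles\<close>.\<close>

primrec elicit ::
    "(voter \<Rightarrow> nat) \<Rightarrow> cand list \<Rightarrow> nat \<Rightarrow> (voter \<rightharpoonup> cand list) \<Rightarrow> algorithm" where
  "elicit pos base 0 M =
     Output (\<lambda>v. case M v of None \<Rightarrow> undefined | Some ys \<Rightarrow> list_order ys)"
| "elicit pos base (Suc j) M =
     Advance (\<lambda>v. sort_query (start_list pos base M v) (\<lambda>ys. elicit pos base j (M(v \<mapsto> ys))))"

definition lists_of :: "cand set \<Rightarrow> (voter \<rightharpoonup> cand list) \<Rightarrow> bool" where
  "lists_of C M \<longleftrightarrow> finite (dom M) \<and> (\<forall>v ys. M v = Some ys \<longrightarrow> distinct ys \<and> set ys = C)"

lemma lists_of_upd [simp]: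
  "lists_of C M \<Longrightarrow> distinct ys \<Longrightarrow> set ys = C \<Longrightarrow> lists_of C (M(v \<mapsto> ys))"
  by (auto simp: lists_of_def)

lemma start_list_nearest:
  assumes "finite (dom M)" "dom M \<noteq> {}"
  obtains w where "M w = Some (start_list pos base M v)"
    and "\<And>u. u \<in> dom M \<Longrightarrow> \<bar>int (pos v) - int (pos w)\<bar> \<le> \<bar>int (pos v) - int (pos u)\<bar>"
proof -
  let ?f = "\<lambda>w. \<bar>int (pos v) - int (pos w)\<bar>"
  have "arg_min_on ?f (dom M) \<in> dom M"
    using arg_min_if_finite(1)[OF assms] .
  moreover have "?f (arg_min_on ?f (dom M)) \<le> ?f u" if "u \<in> dom M" for u
    using arg_min_least[OF assms that] .
  ultimately show ?thesis
    using that[of "arg_min_on ?f (dom M)"] assms(2) by (auto simp: start_list_def)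
qed

lemma start_list_distinct:
  assumes "lists_of C M" "distinct base" "set base = C"
  shows "distinct (start_list pos base M v)" "set (start_list pos base M v) = C"
proof -
  have "distinct (start_list pos base M v) \<and> set (start_list pos base M v) = C"
  proof (cases "dom M = {}")
    case True
    then show ?thesis using assms by (simp add: start_list_def)
  next
    case False
    then obtain w where "M w = Some (start_list pos base M v)"
      using start_list_nearest assms(1) unfolding lists_of_def by metis
    then show ?thesis using assms(1) by (auto simp: lists_of_def)
  qed
  then show "distinct (start_list pos base M v)" "set (start_list pos base M v) = C"
    by auto
qed

lemma admissible_elicit:
  assumes "lists_of C M" "distinct base" "set base = C"
  shows "admissible C (elicit pos base j M)"
  using assms(1)
proof (induction j arbitrary: M)
  case (Suc j)
  have "admissible C (elicit pos base j (M(v \<mapsto> zs)))" if "distinct zs" "set zs = C" for v zs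
    using that by (intro Suc.IH lists_of_upd[OF Suc.prems])
  then show ?case
    using start_list_distinct[OF Suc.prems assms(2,3)]
    by (auto intro!: admissible_sort_query)
qed simp

section \<open>Correctness of the output\<close>

definition known :: "cand set \<Rightarrow> profile \<Rightarrow> (voter \<rightharpoonup> cand list) \<Rightarrow> bool" where
  "known C P M \<longleftrightarrow> lists_of C M \<and> (\<forall>v ys. M v = Some ys \<longrightarrow> list_order ys = P v)"

lemma known_upd:
  assumes "known C P M" "distinct base" "set base = C" "P v \<in> preferences C"
  shows "known C P (M(v \<mapsto> rel_sort (P v) (start_list pos base M v)))"
  using assms start_list_distinct[OF _ assms(2,3), of M pos v]
    list_order_rel_sort[OF assms(4), of "start_list pos base M v"]
  by (auto simp: known_def)

lemma result_elicit:
  assumes "P \<in> profiles C n" "distinct base" "set base = C"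
    and "known C P M" "dom M \<union> set vs = {1..n}"
  shows "result (elicit pos base (length vs) M) P cur vs = Some P"
  using assms(4,5)
proof (induction vs arbitrary: M cur)
  case Nil
  have "(case M v of None \<Rightarrow> undefined | Some ys \<Rightarrow> list_order ys) = P v" for v
  proof (cases "M v")
    case None
    then have "v \<notin> {1..n}" using Nil.prems(2) by (metis Un_empty_right domIff list.set(1))
    then show ?thesis using None assms(1) by (auto simp: profiles_def PiE_def extensional_def)
  next
    case (Some ys)
    then show ?thesis using Nil by (auto simp: known_def)
  qed
  then show ?case by auto
next
  case (Cons v vs)
  have "v \<in> {1..n}" using Cons.prems(2) by auto
  then have "P v \<in> preferences C"
    using assms(1) by (auto simp: profiles_def PiE_def)
  note known = known_upd[OF Cons.prems(1) assms(2,3) this, where pos = pos]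
  have "result (elicit pos base (length vs) (M(v \<mapsto> rel_sort (P v) (start_list pos base M v))))
      P (Some v) vs = Some P"
    using Cons.prems(2) by (intro Cons.IH[OF known]) auto
  then show ?case by simp
qed

section \<open>Query complexity\<close>

text \<open>Here \<open>c\<close> is not the number of charges but the answer of each voter on one
  fixed ordered pair; the number of charges is \<open>q\<close>, and \<open>S\<close> holds the
  elicited voters. The case \<open>q = 0\<close> stands apart because the elicited voters may then
  all agree.\<close>

definition charge_bound :: "nat \<Rightarrow> ('v \<Rightarrow> nat) \<Rightarrow> ('v \<Rightarrow> bool) \<Rightarrow> 'v set \<Rightarrow> nat \<Rightarrow> bool" where
  "charge_bound n pos c S q \<longleftrightarrow>
     q = 0 \<or> (\<exists>a\<in>S. \<exists>b\<in>S. c a \<noteq> c b \<and> 2 ^ q * \<bar>int (pos a) - int (pos b)\<bar> \<le> 2 * int n)"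

lemma charge_bound_log:
  assumes "charge_bound n pos c S q" "inj_on pos S" "n \<ge> 1"
  shows "real q \<le> 1 + log 2 (real n)"
proof (cases "q = 0")
  case True
  then show ?thesis using assms(3) by simp
next
  case False
  then obtain a b where ab: "a \<in> S" "b \<in> S" "c a \<noteq> c b"
      "2 ^ q * \<bar>int (pos a) - int (pos b)\<bar> \<le> 2 * int n"
    using assms(1) by (auto simp: charge_bound_def)
  \<comment> \<open>Distinct voters are at distance at least 1, which leaves
    \<open>2 ^ q \<le> 2 * n\<close>.\<close>
  then have "pos a \<noteq> pos b" using assms(2) by (auto simp: inj_on_def)
  then have "(2::int) ^ q * 1 \<le> 2 ^ q * \<bar>int (pos a) - int (pos b)\<bar>"
    by (intro mult_left_mono) auto
  then have "(2::int) ^ q \<le> 2 * int n" using ab(4) by linarith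
  then have "real_of_int (2 ^ q) \<le> real_of_int (2 * int n)" by (simp only: of_int_le_iff)
  then have "2 ^ q \<le> 2 * real n" by simp
  then have "log 2 (2 ^ q) \<le> log 2 (2 * real n)"
    using assms(3) by (subst log_le_cancel_iff) auto
  then show ?thesis using assms(3) by (simp add: log_mult log_nat_power)
qed

text \<open>The assumption \<open>crossing\<close> makes both answer classes intervals. When
  \<open>v\<close> and its nearest elicited voter \<open>w\<close> disagree, they become the new
  witnesses, at most half as far apart as the old ones.\<close>

lemma charge_bound_step:
  fixes pos :: "'v \<Rightarrow> nat"
  assumes "charge_bound n pos c S q" "S \<subseteq> V" "v \<in> V" "w \<in> S"
    and range: "\<And>u. u \<in> V \<Longrightarrow> pos u \<in> {1..n}"
    and nearest: "\<And>u. u \<in> S \<Longrightarrow> \<bar>int (pos v) - int (pos w)\<bar> \<le> \<bar>int (pos v) - int (pos u)\<bar>"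
    and crossing: "\<And>i j k. i \<in> V \<Longrightarrow> j \<in> V \<Longrightarrow> k \<in> V \<Longrightarrow>
      pos i \<le> pos k \<Longrightarrow> pos k \<le> pos j \<Longrightarrow> c i = c j \<Longrightarrow> c k = c i"
  shows "charge_bound n pos c (insert v S) (q + of_bool (c w \<noteq> c v))"
proof (cases "c w = c v")
  case True
  then show ?thesis using assms(1) by (auto simp: charge_bound_def)
next
  case False
  have "2 ^ Suc q * \<bar>int (pos v) - int (pos w)\<bar> \<le> 2 * int n"
  proof (cases "q = 0")
    case True
    \<comment> \<open>The first charge explains the factor 2 in \<open>2 * n\<close>: there is no
      earlier distance to halve, only the trivial bound \<open>n\<close>.\<close>
    have "\<bar>int (pos v) - int (pos w)\<bar> \<le> int n"
      using range[of v] range[of w] assms(2-4) by fastforce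
    then show ?thesis using True by simp
  next
    case q: False
    \<comment> \<open>The two witnesses are interchangeable, so \<open>a\<close> may be taken as the
      left one.\<close>
    then obtain a b where ab: "a \<in> S" "b \<in> S" "c a \<noteq> c b"
        "2 ^ q * \<bar>int (pos a) - int (pos b)\<bar> \<le> 2 * int n" "pos a \<le> pos b"
      using assms(1) unfolding charge_bound_def
      by (metis (no_types) abs_minus_commute nat_le_linear)
    have V: "a \<in> V" "b \<in> V" "w \<in> V" "v \<in> V"
      using ab assms(2-4) by auto
    \<comment> \<open>If \<open>v\<close> lay left of \<open>a\<close>, nearness would keep
      \<open>w\<close> from passing \<open>a\<close>. Neither \<open>v\<close> nor \<open>w\<close>
      could then answer like \<open>b\<close>, since \<open>a\<close> lies between; as there are
      only two answers, both would answer like \<open>a\<close> and not disagree. The right side is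
      symmetric.\<close>
    have "pos a \<le> pos v \<and> pos v \<le> pos b"
    proof (rule ccontr)
      assume "\<not> ?thesis"
      then consider "pos v < pos a" | "pos b < pos v" by linarith
      then show False
      proof cases
        case 1
        then have "pos w \<le> pos a" using nearest[OF ab(1)] by linarith
        then have "c w = c a"
          using crossing[of w b a] crossing[of w b w] V ab False by auto
        moreover have "c v = c a"
          using crossing[of v b a] V ab 1 by auto
        ultimately show False using False by simp
      next
        case 2
        then have "pos b \<le> pos w" using nearest[OF ab(2)] by linarith
        then have "c w = c b"
          using crossing[of a w b] V ab by auto
        moreover have "c v = c b"
          using crossing[of a v b] V ab 2 by auto
        ultimately show False using False by simp
      qed
    qed
    \<comment> \<open>The distances from \<open>v\<close> to \<open>a\<close> and to
      \<open>b\<close> add up to that between \<open>a\<close> and \<open>b\<close>, and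
      \<open>w\<close> is no farther than either.\<close>
    then have "2 * \<bar>int (pos v) - int (pos w)\<bar> \<le> \<bar>int (pos a) - int (pos b)\<bar>"
      using nearest[OF ab(1)] nearest[OF ab(2)] by auto
    then have "2 ^ q * (2 * \<bar>int (pos v) - int (pos w)\<bar>) \<le> 2 ^ q * \<bar>int (pos a) - int (pos b)\<bar>"
      by (intro mult_left_mono) auto
    moreover have "2 ^ Suc q * \<bar>int (pos v) - int (pos w)\<bar> = 2 ^ q * (2 * \<bar>int (pos v) - int (pos w)\<bar>)"
      by simp
    ultimately show ?thesis using ab(4) by linarith
  qed
  then show ?thesis
    using False assms(4) unfolding charge_bound_def
    by (intro disjI2 bexI[of _ v] bexI[of _ w]) auto
qed

text \<open>This supplies \<open>crossing\<close> for \<open>charge_bound_step\<close>. Single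
  crossing speaks of positive answers only; for a shared negative answer it is applied to
  \<open>y\<close> and \<open>x\<close> in exchanged roles, by totality and asymmetry.\<close>

lemma single_crossing_between:
  assumes \<sigma>: "\<sigma> permutes {1..n}" and P: "P \<in> single_crossing_profiles C n \<sigma>"
    and "x \<in> C" "y \<in> C" and ijk: "i \<in> {1..n}" "j \<in> {1..n}" "k \<in> {1..n}"
    and le: "inv \<sigma> i \<le> inv \<sigma> k" "inv \<sigma> k \<le> inv \<sigma> j"
    and eq: "(x, y) \<in> P i \<longleftrightarrow> (x, y) \<in> P j"
  shows "(x, y) \<in> P k \<longleftrightarrow> (x, y) \<in> P i"
proof -
  have pref: "strict_linear_order_on C (P v)" if "v \<in> {1..n}" for v
    using P that by (auto simp: single_crossing_profiles_def profiles_def preferences_def PiE_def)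
  have swap: "(x, y) \<in> P v \<longleftrightarrow> (y, x) \<notin> P v" if "v \<in> {1..n}" "x \<noteq> y" for v
  proof -
    have "trans (P v)" "irrefl (P v)" "total_on C (P v)"
      using pref[OF that(1)] by (auto simp: strict_linear_order_on_def)
    then show ?thesis
      using that(2) assms(3,4) transD[of "P v" x y x] by (auto simp: irrefl_def total_on_def)
  qed
  have irr: "(x, x) \<notin> P v" if "v \<in> {1..n}" for v
    using pref[OF that] by (auto simp: strict_linear_order_on_def irrefl_def)
  have inv_in: "inv \<sigma> v \<in> {1..n}" if "v \<in> {1..n}" for v
    using permutes_in_image[OF permutes_inv[OF \<sigma>], of v] that by simp
  have [simp]: "\<sigma> (inv \<sigma> v) = v" for v
    using permutes_inverses(1)[OF \<sigma>] .
  have cross: "(u, v) \<in> P k"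
    if "u \<in> C" "v \<in> C" "u \<noteq> v" "(u, v) \<in> P i" "(u, v) \<in> P j" for u v
  \<comment> \<open>The definition compares strictly increasing positions; equal ones force
    \<open>k = i\<close> by injectivity.\<close>
  proof (cases "inv \<sigma> i = inv \<sigma> j")
    case True
    then have "inv \<sigma> k = inv \<sigma> i" using le by simp
    then have "k = i" using inj_eq[OF permutes_inj[OF permutes_inv[OF \<sigma>]]] by blast
    then show ?thesis using that by simp
  next
    case False
    have "single_crossing C n \<sigma> P" using P by (simp add: single_crossing_profiles_def)
    then have "1 \<le> inv \<sigma> i \<and> inv \<sigma> i < inv \<sigma> j \<and> inv \<sigma> j \<le> n \<and>
        (u, v) \<in> P (\<sigma> (inv \<sigma> i)) \<and> (u, v) \<in> P (\<sigma> (inv \<sigma> j)) \<longrightarrow>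
        inv \<sigma> i \<le> inv \<sigma> k \<and> inv \<sigma> k \<le> inv \<sigma> j \<longrightarrow> (u, v) \<in> P (\<sigma> (inv \<sigma> k))"
      using that(1-3) unfolding single_crossing_def by blast
    then show ?thesis
      using that(4,5) False le inv_in[OF ijk(1)] inv_in[OF ijk(2)] by simp
  qed
  show ?thesis
  proof (cases "x = y")
    case True
    then show ?thesis using irr ijk by simp
  next
    case False
    then show ?thesis
      using cross[of x y] cross[of y x] swap[OF ijk(1)] swap[OF ijk(2)] swap[OF ijk(3)]
        eq assms(3,4) by auto
  qed
qed

section \<open>Amortised count of all comparisons\<close>

text \<open>A potential argument: \<open>q\<close> records the charges made so far, and future
  comparisons plus past charges are bounded together. When no voter is left, only the charges
  remain, at most \<open>1 + log 2 n\<close> on each of the \<open>(card C)\<^sup>2\<close> ordered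
  pairs.\<close>

lemma card_comparisons_elicit:
  assumes \<sigma>: "\<sigma> permutes {1..n}" and P: "P \<in> single_crossing_profiles C n \<sigma>"
    and n: "n \<ge> 1" and C: "finite C" and base: "distinct base" "set base = C"
    and "known C P M" "dom M \<noteq> {}" "dom M \<union> set vs \<subseteq> {1..n}"
    and "\<And>x y. x \<in> C \<Longrightarrow> y \<in> C \<Longrightarrow>
      charge_bound n (inv \<sigma>) (\<lambda>v. (x, y) \<in> P v) (dom M) (q (x, y))"
  shows "real (card (comparisons (elicit (inv \<sigma>) base (length vs) M) P cur vs))
           + (\<Sum>e\<in>C \<times> C. real (q e))
         \<le> real (card C * length vs) + (real (card C))\<^sup>2 * (1 + log 2 (real n))"
  using assms(7-10)
proof (induction vs arbitrary: M cur q)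
  case Nil
  have "inj_on (inv \<sigma>) (dom M)"
    using permutes_inj[OF permutes_inv[OF \<sigma>]] by (rule inj_on_subset) simp
  then have "real (q e) \<le> 1 + log 2 (real n)" if "e \<in> C \<times> C" for e
    using charge_bound_log[OF Nil.prems(4)[of "fst e" "snd e"] _ n] that by auto
  then have "(\<Sum>e\<in>C \<times> C. real (q e)) \<le> real (card (C \<times> C)) * (1 + log 2 (real n))"
    by (rule sum_bounded_above)
  then show ?case by (simp add: card_cartesian_product power2_eq_square)
next
  case (Cons v vs)
  let ?xs = "start_list (inv \<sigma>) base M v"
  let ?M = "M(v \<mapsto> rel_sort (P v) ?xs)"
  have v: "v \<in> {1..n}" using Cons.prems(3) by auto
  have "P v \<in> preferences C"
    using P v by (auto simp: single_crossing_profiles_def profiles_def PiE_def)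
  note known = known_upd[OF Cons.prems(1) base this, where pos = "inv \<sigma>"]
  have lists: "lists_of C M" using Cons.prems(1) by (simp add: known_def)
  then obtain w where w: "M w = Some ?xs"
    and nearest: "\<And>u. u \<in> dom M \<Longrightarrow>
      \<bar>int (inv \<sigma> v) - int (inv \<sigma> w)\<bar> \<le> \<bar>int (inv \<sigma> v) - int (inv \<sigma> u)\<bar>"
    using start_list_nearest[OF _ Cons.prems(2), where pos = "inv \<sigma>" and v = v and base = base]
    unfolding lists_of_def by blast
  have xs: "distinct ?xs" "set ?xs = C" "list_order ?xs = P w"
    using start_list_distinct[OF lists base] w Cons.prems(1) by (auto simp: known_def)
  have Pw: "P w \<subseteq> C \<times> C" using list_order_subset[of ?xs] xs by simp
  \<comment> \<open>A disagreement is charged to both orientations of the pair, which keeps the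
    charge a function of the answers alone.\<close>
  define q' where "q' e = q e + of_bool ((e \<in> P w) \<noteq> (e \<in> P v))" for e
  have "charge_bound n (inv \<sigma>) (\<lambda>v. (x, y) \<in> P v) (dom ?M) (q' (x, y))"
    if "x \<in> C" "y \<in> C" for x y
  proof -
    have "charge_bound n (inv \<sigma>) (\<lambda>v. (x, y) \<in> P v) (insert v (dom M)) (q' (x, y))"
      unfolding q'_def
    proof (rule charge_bound_step[OF Cons.prems(4)[OF that], where V = "{1..n}"])
      show "dom M \<subseteq> {1..n}" using Cons.prems(3) by auto
      show "inv \<sigma> u \<in> {1..n}" if "u \<in> {1..n}" for u
        using permutes_in_image[OF permutes_inv[OF \<sigma>], of u] that by simp
      show "((x, y) \<in> P k) = ((x, y) \<in> P i)"
        if "i \<in> {1..n}" "j \<in> {1..n}" "k \<in> {1..n}" "inv \<sigma> i \<le> inv \<sigma> k" "inv \<sigma> k \<le> inv \<sigma> j"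
          "((x, y) \<in> P i) = ((x, y) \<in> P j)" for i j k
        by (rule single_crossing_between[OF \<sigma> P \<open>x \<in> C\<close> \<open>y \<in> C\<close> that])
    qed (use v w nearest in blast)+
    then show ?thesis by simp
  qed
  then have IH: "real (card (comparisons (elicit (inv \<sigma>) base (length vs) ?M) P (Some v) vs))
           + (\<Sum>e\<in>C \<times> C. real (q' e))
         \<le> real (card C * length vs) + (real (card C))\<^sup>2 * (1 + log 2 (real n))"
    using Cons.prems(3) by (intro Cons.IH[OF known]) (auto simp del: fun_upd_apply)
  \<comment> \<open>The sort pays for one orientation of each disagreement, so the new charges cover
    its inversions.\<close>
  have "card (P w - P v) = (\<Sum>e\<in>C \<times> C. of_bool (e \<in> P w - P v))"
  proof -
    have "(C \<times> C) \<inter> {e. e \<in> P w - P v} = P w - P v" using Pw by auto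
    then show ?thesis using C by (simp only: sum_of_bool_eq finite_cartesian_product of_nat_id)
  qed
  also have "\<dots> \<le> (\<Sum>e\<in>C \<times> C. of_bool ((e \<in> P w) \<noteq> (e \<in> P v)))"
    by (intro sum_mono) auto
  finally have "card (P w - P v) + (\<Sum>e\<in>C \<times> C. q e) \<le> (\<Sum>e\<in>C \<times> C. q' e)"
    by (simp only: q'_def sum.distrib add.commute add_left_mono)
  then have "real (card (P w - P v)) + (\<Sum>e\<in>C \<times> C. real (q e)) \<le> (\<Sum>e\<in>C \<times> C. real (q' e))"
    by (simp only: of_nat_sum[symmetric] of_nat_add[symmetric] of_nat_le_iff)
  moreover have "card (comparisons (elicit (inv \<sigma>) base (length (v # vs)) M) P cur (v # vs))
      \<le> card C + card (P w - P v)
         + card (comparisons (elicit (inv \<sigma>) base (length vs) ?M) P (Some v) vs)"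
    using card_comparisons_sort_query[of ?xs
        "\<lambda>ys. elicit (inv \<sigma>) base (length vs) (M(v \<mapsto> ys))" P v vs]
      inversions_eq_card[OF xs(1), of "P v"] xs distinct_card[OF xs(1)]
    by simp
  ultimately show ?case
    using IH by (simp add: algebra_simps)
qed

text \<open>The first voter is sorted from the arbitrary list \<open>base\<close>, whose inversions
  are not charged but bounded by all ordered pairs. This turns \<open>1 + log 2 n\<close> into
  \<open>2 + log 2 n\<close>.\<close>

lemma card_comparisons_elicit_empty:
  assumes \<sigma>: "\<sigma> permutes {1..n}" and P: "P \<in> single_crossing_profiles C n \<sigma>"
    and n: "n \<ge> 1" and C: "finite C" and base: "distinct base" "set base = C"
    and vs: "set vs \<subseteq> {1..n}"
  shows "real (card (comparisons (elicit (inv \<sigma>) base (length vs) Map.empty) P None vs))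
         \<le> real (card C * length vs) + (real (card C))\<^sup>2 * (2 + log 2 (real n))"
proof (cases vs)
  case Nil
  then show ?thesis using n by simp
next
  case (Cons v us)
  let ?M = "[v \<mapsto> rel_sort (P v) base]"
  have v: "v \<in> {1..n}" using vs Cons by auto
  have "P v \<in> preferences C"
    using P v by (auto simp: single_crossing_profiles_def profiles_def PiE_def)
  moreover have "start_list (inv \<sigma>) base Map.empty v = base" by (simp add: start_list_def)
  moreover have "known C P Map.empty" by (simp add: known_def lists_of_def)
  ultimately have known: "known C P ?M"
    using known_upd[OF _ base, of P Map.empty v "inv \<sigma>"] by simp
  \<comment> \<open>With a single elicited voter the charges start at zero.\<close>
  have rest: "real (card (comparisons (elicit (inv \<sigma>) base (length us) ?M) P (Some v) us))
           + (\<Sum>e\<in>C \<times> C. real ((\<lambda>_. 0) e))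
         \<le> real (card C * length us) + (real (card C))\<^sup>2 * (1 + log 2 (real n))"
    by (rule card_comparisons_elicit[OF \<sigma> P n C base known])
      (use vs Cons in \<open>auto simp: charge_bound_def\<close>)
  have "list_order base - P v \<subseteq> C \<times> C"
    using list_order_subset[of base] base by auto
  then have "card (list_order base - P v) \<le> card (C \<times> C)"
    using C by (intro card_mono) auto
  then have "inversions (P v) base \<le> (card C)\<^sup>2"
    using inversions_eq_card[OF base(1)]
    by (simp add: card_cartesian_product power2_eq_square)
  then have "card (comparisons (elicit (inv \<sigma>) base (length vs) Map.empty) P None vs)
      \<le> card C + (card C)\<^sup>2
         + card (comparisons (elicit (inv \<sigma>) base (length us) ?M) P (Some v) us)"
    using card_comparisons_sort_query[of base
        "\<lambda>ys. elicit (inv \<sigma>) base (length us) [v \<mapsto> ys]" P v us]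
      distinct_card[OF base(1)] base(2) Cons
    by (simp add: start_list_def)
  then have "real (card (comparisons (elicit (inv \<sigma>) base (length vs) Map.empty) P None vs))
      \<le> real (card C) + (real (card C))\<^sup>2
         + real (card (comparisons (elicit (inv \<sigma>) base (length us) ?M) P (Some v) us))"
    by (simp only: of_nat_le_iff of_nat_add[symmetric] of_nat_power[symmetric])
  then show ?thesis
    using rest Cons by (simp add: algebra_simps)
qed

theorem theorem4:
  "\<exists>K::real. K > 0 \<and>
     (\<forall>(m::nat) (n::nat) (C::cand set) (\<sigma>::nat \<Rightarrow> voter) (\<pi>::nat \<Rightarrow> voter).
        m \<ge> 2 \<and> n \<ge> 2 \<and> finite C \<and> card C = m \<and>
        \<sigma> permutes {1..n} \<and> \<pi> permutes {1..n} \<longrightarrow>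
        (\<exists>A. elicits C (map \<pi> [1..<Suc n]) (single_crossing_profiles C n \<sigma>) A \<and>
             real (query_complexity (map \<pi> [1..<Suc n]) (single_crossing_profiles C n \<sigma>) A)
               \<le> K * (real m * real n + (real m)\<^sup>2 * log 2 (real n))))"
proof (intro exI[of _ 3] conjI allI impI)
  fix m n :: nat and C :: "cand set" and \<sigma> \<pi> :: "nat \<Rightarrow> voter"
  assume asm: "m \<ge> 2 \<and> n \<ge> 2 \<and> finite C \<and> card C = m \<and>
    \<sigma> permutes {1..n} \<and> \<pi> permutes {1..n}"
  define vs where "vs = map \<pi> [1..<Suc n]"
  let ?F = "single_crossing_profiles C n \<sigma>"
  let ?base = "sorted_list_of_set C"
  let ?A = "elicit (inv \<sigma>) ?base (length vs) Map.empty"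
  have \<sigma>: "\<sigma> permutes {1..n}" and n: "n \<ge> 1" and C: "finite C" using asm by auto
  have base: "distinct ?base" "set ?base = C" using C by auto
  \<comment> \<open>The order of arrival enters the argument through these two facts, so every \<pi>
    is covered.\<close>
  have set_vs: "set vs = {1..n}" and length_vs: "length vs = n"
    using permutes_image[of \<pi> "{1..n}"] asm
    by (simp_all add: vs_def atLeastLessThanSuc_atLeastAtMost del: upt_Suc)
  have "elicits C vs ?F ?A"
    unfolding elicits_def
  proof (intro conjI ballI)
    show "admissible C ?A"
      using base by (intro admissible_elicit) (auto simp: lists_of_def)
    show "result ?A P None vs = Some P" if "P \<in> ?F" for P
    proof (rule result_elicit[OF _ base])
      show "P \<in> profiles C n" using that by (simp add: single_crossing_profiles_def)
    qed (use set_vs in \<open>simp_all add: known_def lists_of_def\<close>)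
  qed
  moreover have "real (query_complexity vs ?F ?A)
      \<le> 3 * (real m * real n + (real m)\<^sup>2 * log 2 (real n))"
  proof -
    \<comment> \<open>The maximum is attained, so a bound for each single profile suffices.\<close>
    have "query_complexity vs ?F ?A \<in> (\<lambda>P. card (comparisons ?A P None vs)) ` ?F"
      unfolding query_complexity_def
      using finite_single_crossing_profiles[OF C] single_crossing_profiles_nonempty[OF \<sigma>]
      by (intro Max_in) auto
    then obtain P where P: "P \<in> ?F"
      and eq: "query_complexity vs ?F ?A = card (comparisons ?A P None vs)" by blast
    have "real (card (comparisons ?A P None vs))
        \<le> real (card C * length vs) + (real (card C))\<^sup>2 * (2 + log 2 (real n))"
      using set_vs by (intro card_comparisons_elicit_empty[OF \<sigma> P n C base]) simp
    also have "\<dots> = real m * real n + (real m)\<^sup>2 * (2 + log 2 (real n))"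
      using asm length_vs by simp
    \<comment> \<open>As n is at least 2, the logarithm is at least 1 and absorbs the constant 2;
      hence the factor 3.\<close>
    also have "\<dots> \<le> real m * real n + (real m)\<^sup>2 * (3 * log 2 (real n))"
    proof -
      have "1 \<le> log 2 (real n)" using asm by simp
      then show ?thesis by (intro add_left_mono mult_left_mono) auto
    qed
    also have "\<dots> \<le> 3 * (real m * real n + (real m)\<^sup>2 * log 2 (real n))"
      by (simp add: algebra_simps)
    finally show ?thesis unfolding eq .
  qed
  ultimately show "\<exists>A. elicits C (map \<pi> [1..<Suc n]) ?F A \<and>
      real (query_complexity (map \<pi> [1..<Suc n]) ?F A)
        \<le> 3 * (real m * real n + (real m)\<^sup>2 * log 2 (real n))"
    unfolding vs_def by blast
qed simp

end
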